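(* Let $K$ be a field, let $\mathbf{A}=K\{\{x\}\}_\infty$ be the $K$-algebra of planar tree power series in $x$ over $K$, and let $f\in\mathbf{A}$. Then there is a unique $g\in\mathbf{A}$ with $\mathrm{ord}(g)\ge 1$ such that $$g(x)=x\cdot f(g(x)).$$
   Context: Trees: $\mathbf{PRT}$ is the set of isomorphism classes of finite planar reduced rooted trees, i.e. finite rooted trees in which the outgoing edges (children) of each vertex are linearly ordered and no vertex has exactly one child. $\mathbf{PRT}'=\mathbf{PRT}\cup\{1\}$, where $1$ is the empty tree. The tree with a single vertex is denoted $x$. The degree $\deg(T)$ is the number of leaves (vertices without children) of $T$, and $\deg(1)=0$. The leaves of a planar tree are ordered from left to right. Product of trees: for $S,T\in\mathbf{PRT}$, $S\cdot T$ is the tree whose root has exactly two children, the first branch being $S$ and the second being $T$; moreover $1\cdot T=T\cdot 1=T$ for all $T\in\mathbf{PRT}'$. This product is neither associative nor commutative. Planar tree power series: $\mathbf{A}=K\{\{x\}\}_\infty$ is the $K$-vector space of formal sums $f=\sum_{T\in\mathbf{PRT}'}c_T(f)\,T$ with arbitrary coefficients $c_T(f)\in K$. Multiplication is $c_T(f\cdot h)=\sum_{(R,S):\,R\cdot S=T}c_R(f)c_S(h)$ (a finite sum over pairs $(R,S)\in\mathbf{PRT}'\times\mathbf{PRT}'$). The order $\mathrm{ord}(f)$ is the minimal degree of a $T$ with $c_T(f)\ne0$, with $\mathrm{ord}(0)=\infty$. Substitution: for $T\in\mathbf{PRT}$ of degree $n$ and $T_1,\dots,T_n\in\mathbf{PRT}$,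 let $*_T(T_1,\dots,T_n)$ be the tree obtained from $T$ by replacing the $i$-th leaf of $T$ by $T_i$ (the root of $T_i$ being identified with that leaf) for all $i$. If $g\in\mathbf{A}$ has $\mathrm{ord}(g)\ge1$, put $1(g)=1$, $T(g)=\sum_{T_1,\dots,T_n\in\mathbf{PRT}}c_{T_1}(g)\cdots c_{T_n}(g)\,*_T(T_1,\dots,T_n)$, and $f(g(x))=\sum_{T\in\mathbf{PRT}'}c_T(f)\,T(g)$; each coefficient of the result is a finite sum. *)

theory Defs
  imports Main "HOL-Library.Extended_Nat" "HOL-Library.Groups_Big_Fun"
begin

text \<open>
  Finite planar reduced rooted trees. A vertex is either a leaf or has a first child, a
  second child and a (possibly empty) list of further children, so no vertex has exactly one
  child, and equality is isomorphism of planar trees. \<open>Leaf\<close> is the one-vertex tree $x$.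
\<close>

datatype prt = Leaf | Node prt prt "prt list"

text \<open>Trees together with the empty tree $1$, which is \<open>None\<close>.\<close>

type_synonym prt1 = "prt option"

fun leaves :: "prt \<Rightarrow> nat" where
  "leaves Leaf = 1"
| "leaves (Node a b cs) = leaves a + leaves b + sum_list (map leaves cs)"

definition deg :: "prt1 \<Rightarrow> nat" where
  "deg T = (case T of None \<Rightarrow> 0 | Some t \<Rightarrow> leaves t)"

fun tree_mult :: "prt1 \<Rightarrow> prt1 \<Rightarrow> prt1" where
  "tree_mult None T = T"
| "tree_mult S None = S"
| "tree_mult (Some s) (Some t) = Some (Node s t [])"

text \<open>
  \<open>graft t ts\<close> replaces the leaves of \<open>t\<close>, from left to right, by the members of \<open>ts\<close>; it is
  only meaningful (and only used) for \<open>length ts = leaves t\<close>. The list is cut into consecutive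
  blocks, one for each child of the root.
\<close>

fun graft :: "prt \<Rightarrow> prt list \<Rightarrow> prt"
  and graft_forest :: "prt list \<Rightarrow> prt list \<Rightarrow> prt list" where
  "graft Leaf ts = hd ts"
| "graft (Node a b cs) ts =
     Node (graft a (take (leaves a) ts))
          (graft b (take (leaves b) (drop (leaves a) ts)))
          (graft_forest cs (drop (leaves a + leaves b) ts))"
| "graft_forest [] ts = []"
| "graft_forest (c # cs) ts =
     graft c (take (leaves c) ts) # graft_forest cs (drop (leaves c) ts)"

text \<open>A planar tree power series is its family of coefficients: \<open>f T\<close> is $c_T(f)$.\<close>

type_synonym 'k tree_series = "prt1 \<Rightarrow> 'k"

definition X :: "'k::field tree_series" where
  "X T = (if T = Some Leaf then 1 else 0)"

definition one_series :: "'k::field tree_series" where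
  "one_series T = (if T = None then 1 else 0)"

definition series_mult :: "'k::field tree_series \<Rightarrow> 'k tree_series \<Rightarrow> 'k tree_series"
    (infixl \<open>\<cdot>\<close> 70) where
  "(f \<cdot> h) T = (\<Sum>(R, S) | tree_mult R S = T. f R * h S)"

text \<open>The infimum of the empty set is \<open>\<infinity>\<close>, so the zero series has order \<open>\<infinity>\<close>.\<close>

definition ord :: "'k::field tree_series \<Rightarrow> enat" where
  "ord f = (INF T\<in>{T. f T \<noteq> 0}. enat (deg T))"

text \<open>
  \<open>tree_subst T g\<close> is $T(g)$. The \<open>T\<^sub>i\<close> range over nonempty trees only, which is the intended
  substitution when \<open>ord g \<ge> 1\<close>.
\<close>

definition tree_subst :: "prt1 \<Rightarrow> 'k::field tree_series \<Rightarrow> 'k tree_series" where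
  "tree_subst T g = (case T of
      None \<Rightarrow> one_series
    | Some t \<Rightarrow> (\<lambda>S. \<Sum>ts | length ts = leaves t \<and> Some (graft t ts) = S.
                      prod_list (map (\<lambda>u. g (Some u)) ts)))"

text \<open>
  \<open>series_subst f g\<close> is $f(g(x))$. The constant \<open>Sum_any\<close> sums over the support, which is finite
  by \<open>finite_series_subst_support\<close> below.
\<close>

definition series_subst :: "'k::field tree_series \<Rightarrow> 'k tree_series \<Rightarrow> 'k tree_series" where
  "series_subst f g S = Sum_any (\<lambda>T. f T * tree_subst T g S)"

text \<open>All the sums above are genuinely finite.\<close>

lemma finite_tree_mult_pairs: "finite {(R, S). tree_mult R S = T}"
proof (rule finite_subset)
  let ?B = "{None, T} \<union> (case T of Some (Node a b cs) \<Rightarrow> {Some a, Some b} | _ \<Rightarrow> {})"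
  show "{(R, S). tree_mult R S = T} \<subseteq> ?B \<times> ?B"
  proof clarify
    fix R S assume "T = tree_mult R S"
    then show "R \<in> {None, tree_mult R S} \<union> (case tree_mult R S of Some (Node a b cs) \<Rightarrow> {Some a, Some b} | _ \<Rightarrow> {})
        \<and> S \<in> {None, tree_mult R S} \<union> (case tree_mult R S of Some (Node a b cs) \<Rightarrow> {Some a, Some b} | _ \<Rightarrow> {})"
      by (cases R; cases S) simp_all
  qed
  show "finite (?B \<times> ?B)"
    by (auto split: option.splits prt.splits)
qed

lemma graft_inj:
  "length ts = leaves t \<Longrightarrow> length us = leaves t \<Longrightarrow> graft t ts = graft t us \<Longrightarrow> ts = us"
  and graft_forest_inj:
  "length ts = sum_list (map leaves cs) \<Longrightarrow> length us = sum_list (map leaves cs) \<Longrightarrow>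
     graft_forest cs ts = graft_forest cs us \<Longrightarrow> ts = us"
proof (induction t ts and cs ts arbitrary: us and us rule: graft_graft_forest.induct)
  case (1 ts)
  then show ?case by (cases ts; cases us) auto
next
  case (2 a b cs ts)
  have a: "take (leaves a) ts = take (leaves a) us"
    using 2 by auto
  have b: "take (leaves b) (drop (leaves a) ts) = take (leaves b) (drop (leaves a) us)"
    using 2 by auto
  have c: "drop (leaves a + leaves b) ts = drop (leaves a + leaves b) us"
    using 2 by auto
  have "drop (leaves a) ts = drop (leaves a) us"
    using b c append_take_drop_id[of "leaves b" "drop (leaves a) ts"]
      append_take_drop_id[of "leaves b" "drop (leaves a) us"]
    by (simp add: add.commute)
  then show ?case
    using a by (metis append_take_drop_id)
next
  case (3 ts)
  then show ?case by simp
next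
  case (4 c cs ts)
  have "take (leaves c) ts = take (leaves c) us" "drop (leaves c) ts = drop (leaves c) us"
    using 4 by auto
  then show ?case by (metis append_take_drop_id)
qed

lemma finite_graft_lists: "finite {ts. length ts = leaves t \<and> Some (graft t ts) = S}"
proof (cases "{ts. length ts = leaves t \<and> Some (graft t ts) = S} = {}")
  case False
  then obtain us where us: "length us = leaves t" "Some (graft t us) = S" by blast
  have "{ts. length ts = leaves t \<and> Some (graft t ts) = S} \<subseteq> {us}"
    using us graft_inj by auto
  then show ?thesis by (rule finite_subset) simp
next
  case True
  then show ?thesis by (simp only: finite.emptyI)
qed

lemma graft_forest_eq_length: "length (graft_forest cs ts) = length cs"
  by (induction cs arbitrary: ts) auto

lemma graft_forest_mem:
  "c \<in> set cs \<Longrightarrow> \<exists>us. graft c us \<in> set (graft_forest cs ts)"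
  by (induction cs arbitrary: ts) auto

lemma finite_graft_shapes: "finite {t. \<exists>ts. graft t ts = s}"
proof (induction s)
  case Leaf
  have "{t. \<exists>ts. graft t ts = Leaf} \<subseteq> {Leaf}"
    by (auto elim: graft.elims)
  then show ?case by (rule finite_subset) simp
next
  case (Node a b cs)
  let ?A = "\<lambda>s. {t. \<exists>ts. graft t ts = s}"
  let ?L = "{xs. set xs \<subseteq> (\<Union>c\<in>set cs. ?A c) \<and> length xs = length cs}"
  have fin: "finite ?L"
    using Node by (intro finite_lists_length_eq finite_UN_I) auto
  have "?A (Node a b cs) \<subseteq> insert Leaf ((\<lambda>(x, y, zs). Node x y zs) ` (?A a \<times> ?A b \<times> ?L))"
  proof
    fix t assume "t \<in> ?A (Node a b cs)"
    then obtain ts where ts: "graft t ts = Node a b cs" by blast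
    show "t \<in> insert Leaf ((\<lambda>(x, y, zs). Node x y zs) ` (?A a \<times> ?A b \<times> ?L))"
    proof (cases t)
      case (Node x y zs)
      have "zs \<in> ?L"
        using ts Node graft_forest_mem graft_forest_eq_length by fastforce
      moreover have "x \<in> ?A a" "y \<in> ?A b" using ts Node by auto
      ultimately show ?thesis using Node by (auto simp: image_iff)
    qed simp
  qed
  then show ?case
    by (rule finite_subset) (use fin Node in auto)
qed

lemma finite_series_subst_support: "finite {T. f T * tree_subst T g S \<noteq> 0}"
proof (cases S)
  case None
  have "{T. f T * tree_subst T g S \<noteq> 0} \<subseteq> {None}"
    using None by (auto simp: tree_subst_def split: option.splits)
  then show ?thesis by (rule finite_subset) simp
next
  case (Some s)
  have "{T. f T * tree_subst T g S \<noteq> 0} \<subseteq> insert None (Some ` {t. \<exists>ts. graft t ts = s})"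
  proof
    fix T assume T: "T \<in> {T. f T * tree_subst T g S \<noteq> 0}"
    show "T \<in> insert None (Some ` {t. \<exists>ts. graft t ts = s})"
    proof (cases T)
      case (Some t)
      have "\<exists>ts. graft t ts = s"
      proof (rule ccontr)
        assume "\<nexists>ts. graft t ts = s"
        then have "tree_subst T g S = 0"
          using Some \<open>S = Some s\<close> by (simp add: tree_subst_def)
        then show False using T by simp
      qed
      then show ?thesis using Some by simp
    qed simp
  qed
  then show ?thesis
    by (rule finite_subset) (simp add: finite_graft_shapes)
qed

end

theory Submission
  imports Defs
begin

text \<open>
  The equation is a recursion on the degree. Multiplication by \<open>X\<close> on the left raises degrees
  by one, because the only trees that contribute to a coefficient of \<open>X \<cdot> h\<close> are
  \<open>Some Leaf\<close> times something (\<open>X_mult_cong\<close>). Substitution does not lower degrees: a grafted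
  tree has as many leaves as all the inserted trees together, so a coefficient of $f(g)$ in degree
  $n$ involves only coefficients of $g$ in degrees $1, \dots, n$ (\<open>series_subst_cong\<close>).
  Hence each coefficient of $x \cdot f(g)$ is a function of the coefficients of $g$ in strictly
  smaller degree, and well-founded recursion yields exactly one fixed point.

  That fixed point has order at least one, because \<open>X\<close> times any series has vanishing constant
  term (\<open>X_mult_None\<close>).
\<close>

lemma leaves_pos: "leaves t > 0"
  by (induction t) auto

lemma leaves_graft:
  "length ts = leaves t \<Longrightarrow> leaves (graft t ts) = sum_list (map leaves ts)"
  and leaves_graft_forest:
  "length ts = sum_list (map leaves cs) \<Longrightarrow>
     sum_list (map leaves (graft_forest cs ts)) = sum_list (map leaves ts)"
proof (induction t ts and cs ts rule: graft_graft_forest.induct)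
  case (1 ts)
  then show ?case by (cases ts) auto
next
  case (2 a b cs ts)
  \<comment> \<open>The three blocks into which \<open>graft\<close> cuts the list make up the whole list.\<close>
  have "ts = take (leaves a) ts @ take (leaves b) (drop (leaves a) ts)
      @ drop (leaves a + leaves b) ts"
    by (metis add.commute append_take_drop_id drop_drop)
  then have "sum_list (map leaves ts) = sum_list (map leaves (take (leaves a) ts))
      + sum_list (map leaves (take (leaves b) (drop (leaves a) ts)))
      + sum_list (map leaves (drop (leaves a + leaves b) ts))"
    by (metis add.assoc map_append sum_list_append)
  then show ?case using 2 by simp
next
  case (3 ts)
  then show ?case by simp
next
  case (4 c cs ts)
  have "sum_list (map leaves ts) = sum_list (map leaves (take (leaves c) ts))
      + sum_list (map leaves (drop (leaves c) ts))"
    by (metis append_take_drop_id map_append sum_list_append)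
  then show ?case using 4 by simp
qed

lemma leaves_le_leaves_graft:
  assumes "length ts = leaves t" "u \<in> set ts"
  shows "leaves u \<le> leaves (graft t ts)"
  using assms by (simp add: leaves_graft member_le_sum_list)

text \<open>
  No tree inserted into another is larger than the result, so the coefficient of $f(g)$ at \<open>S\<close>
  sees only a truncation of $g$. Only nonempty trees are inserted, which is why the hypothesis
  compares \<open>g\<close> and \<open>h\<close> at arguments of the form \<open>Some u\<close>.
\<close>

lemma series_subst_cong:
  assumes "\<And>u. leaves u \<le> deg S \<Longrightarrow> g (Some u) = h (Some u)"
  shows "series_subst f g S = series_subst f h S"
proof -
  have "tree_subst T g S = tree_subst T h S" for T
  proof (cases T)
    case None
    then show ?thesis by (simp add: tree_subst_def)
  next
    case (Some t)
    have "prod_list (map (\<lambda>u. g (Some u)) ts) = prod_list (map (\<lambda>u. h (Some u)) ts)"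
      if "length ts = leaves t" "Some (graft t ts) = S" for ts
    proof -
      have "g (Some u) = h (Some u)" if "u \<in> set ts" for u
        using leaves_le_leaves_graft[OF \<open>length ts = leaves t\<close> that] \<open>Some (graft t ts) = S\<close>
        by (intro assms) (auto simp: deg_def)
      then show ?thesis by (simp cong: map_cong)
    qed
    then show ?thesis
      using Some by (auto simp: tree_subst_def intro!: sum.cong)
  qed
  then show ?thesis by (simp add: series_subst_def)
qed

lemma deg_tree_mult: "deg (tree_mult R S) = deg R + deg S"
  by (cases "(R, S)" rule: tree_mult.cases) (auto simp: deg_def)

text \<open>
  The degree is additive and \<open>X\<close> is concentrated in degree one, so $x \cdot h$ is
  $h$ shifted by one degree.
\<close>

lemma X_mult_cong:
  assumes "\<And>S. deg S < deg T \<Longrightarrow> g S = h S"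
  shows "(X \<cdot> g) T = (X \<cdot> h) T"
  unfolding series_mult_def
proof (intro sum.cong refl, clarify)
  fix R S assume T: "T = tree_mult R S"
  show "X R * g S = X R * h S"
  proof (cases "R = Some Leaf")
    case True
    then have "deg S < deg T" by (simp add: T deg_tree_mult) (simp add: deg_def)
    then show ?thesis by (simp add: assms)
  qed (simp add: X_def)
qed

lemma X_mult_None: "(X \<cdot> h) None = 0"
proof -
  have "X R * h S = 0" if "tree_mult R S = None" for R S
    using that by (cases R; cases S) (auto simp: X_def)
  then show ?thesis
    by (auto simp: series_mult_def intro!: sum.neutral)
qed

lemma ord_ge_1_iff: "ord g \<ge> 1 \<longleftrightarrow> g None = 0"
proof -
  have "1 \<le> enat (deg T) \<longleftrightarrow> T \<noteq> None" for T
    using leaves_pos by (auto simp: deg_def one_enat_def Suc_le_eq split: option.splits)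
  then have "ord g \<ge> 1 \<longleftrightarrow> (\<forall>T. g T \<noteq> 0 \<longrightarrow> T \<noteq> None)"
    by (simp only: ord_def le_INF_iff mem_Collect_eq Ball_def)
  then show ?thesis by metis
qed

text \<open>
  The assumption \<open>adm_wf R F\<close> says that \<open>F g x\<close> depends only on the values of \<open>g\<close> below \<open>x\<close>.
  So \<open>g = F g\<close> is a recursive definition of \<open>g\<close>: recursion gives a solution, and induction along
  \<open>R\<close> shows that any other solution agrees with it.
\<close>

lemma adm_wf_ex1_fixpoint:
  assumes wf: "wf R" and adm: "adm_wf R F"
  shows "\<exists>!g. g = F g"
proof (rule ex1I)
  show "wfrec R F = F (wfrec R F)"
    by (rule wfrec_fixpoint[OF wf adm])
next
  fix g assume g: "g = F g"
  show "g = wfrec R F"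
  proof
    fix x show "g x = wfrec R F x"
      using wf
    proof (induction x)
      case (less x)
      then have "F g x = F (wfrec R F) x"
        using adm by (auto simp: adm_wf_def)
      then show ?case
        using g wfrec_fixpoint[OF wf adm] by metis
    qed
  qed
qed

theorem proposition4p2:
  fixes f :: "'k::field tree_series"
  shows "\<exists>!g :: 'k tree_series. ord g \<ge> 1 \<and> g = X \<cdot> series_subst f g"
proof -
  let ?F = "\<lambda>g :: 'k tree_series. X \<cdot> series_subst f g"
  have "adm_wf (measure deg) ?F"
    unfolding adm_wf_def
  proof (intro allI impI)
    fix g h :: "'k tree_series" and T
    assume eq: "\<forall>U. (U, T) \<in> measure deg \<longrightarrow> g U = h U"
    show "?F g T = ?F h T"
    proof (intro X_mult_cong series_subst_cong)
      fix S u assume "deg S < deg T" "leaves u \<le> deg S"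
      then have "deg (Some u) < deg T" by (simp add: deg_def)
      then show "g (Some u) = h (Some u)" using eq by simp
    qed
  qed
  then have "\<exists>!g. g = ?F g"
    by (intro adm_wf_ex1_fixpoint) auto
  moreover have "ord g \<ge> 1" if "g = ?F g" for g
    using X_mult_None[of "series_subst f g"] that by (simp add: ord_ge_1_iff)
  ultimately show ?thesis by blast
qed

end
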